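(* Let $n\ge 2$ be an integer, $\omega=e^{2\pi i/n}$, and let $m$ be a fixed integer in $\{0,1,\dots,n-1\}$. The equation $$F(x+\omega^m y)=\Omega^{-m}F(y)\,\Omega^{m}F(x)\qquad (x,y\in\mathbb{C}),$$ for circulant $n\times n$ matrix functions $F$ on $\mathbb{C}$, is stable if and only if $\gcd(n,m)=1$.
   Context: Here $\Omega=\mathrm{diag}[1,\omega,\dots,\omega^{n-1}]$. A circulant $n\times n$ matrix function on $\mathbb{C}$ is a function $F$ assigning to each $x\in\mathbb{C}$ a complex circulant matrix $\mathrm{circ}(f_0(x),\dots,f_{n-1}(x))$, where $\mathrm{circ}(a_0,\dots,a_{n-1})$ has $(j,k)$ entry $a_{(k-j)\bmod n}$ for $0\le j,k\le n-1$, and $f_0,\dots,f_{n-1}:\mathbb{C}\to\mathbb{C}$ are arbitrary functions. For a square matrix $A=(a_{ij})$, $\|A\|=\max_{1\le i\le n}\sum_{j=1}^n|a_{ij}|$. For fixed $m$, the equation is called stable if every circulant matrix function $F$ on $\mathbb{C}$ for which there is some $\varepsilon>0$ with $$\|F(x+\omega^m y)-\Omega^{-m}F(y)\,\Omega^{m}F(x)\|<\varepsilon\quad\text{for all }x,y\in\mathbb{C}$$ either is bounded (i.e. $\sup_{x\in\mathbb{C}}\|F(x)\|<\infty$) or satisfies $F(x+\omega^m y)=\Omega^{-m}F(y)\Omega^{m}F(x)$ for all $x,y\in\mathbb{C}$. (By convention $\gcd(n,0)=n$.) *)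

theory Defs
  imports Complex_Main "Jordan_Normal_Form.Matrix"
begin

definition omega :: "nat \<Rightarrow> complex" where
  "omega n = exp (2 * of_real pi * \<i> / of_nat n)"

definition Omega :: "nat \<Rightarrow> complex mat" where
  "Omega n = mat_diag n (\<lambda>j. omega n ^ j)"

text \<open>The inverse of \<open>Omega n\<close>, see \<open>Omega_inverts\<close> below.\<close>

definition Omega_inv :: "nat \<Rightarrow> complex mat" where
  "Omega_inv n = mat_diag n (\<lambda>j. inverse (omega n ^ j))"

lemma Omega_inverts:
  "inverts_mat (Omega n) (Omega_inv n)" "inverts_mat (Omega_inv n) (Omega n)"
  by (simp_all add: inverts_mat_def Omega_def Omega_inv_def omega_def carrier_matD(1)[OF mat_diag_dim])

definition circ :: "nat \<Rightarrow> (nat \<Rightarrow> complex) \<Rightarrow> complex mat" where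
  "circ n a = mat n n (\<lambda>(j, k). a (nat ((int k - int j) mod int n)))"

definition circulant_fun :: "nat \<Rightarrow> (complex \<Rightarrow> complex mat) \<Rightarrow> bool" where
  "circulant_fun n F \<longleftrightarrow>
    (\<exists>f :: nat \<Rightarrow> complex \<Rightarrow> complex. \<forall>x. F x = circ n (\<lambda>i. f i x))"

text \<open>Only meaningful for matrices with at least one row, as \<open>Max {}\<close> is unspecified.\<close>

definition row_sum_norm :: "complex mat \<Rightarrow> real" where
  "row_sum_norm A = Max ((\<lambda>i. \<Sum>j<dim_col A. cmod (A $$ (i, j))) ` {..<dim_row A})"

definition twisted_prod ::
  "nat \<Rightarrow> nat \<Rightarrow> (complex \<Rightarrow> complex mat) \<Rightarrow> complex \<Rightarrow> complex \<Rightarrow> complex mat" where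
  "twisted_prod n m F x y = (Omega_inv n ^\<^sub>m m) * F y * (Omega n ^\<^sub>m m) * F x"

definition equation_stable :: "nat \<Rightarrow> nat \<Rightarrow> bool" where
  "equation_stable n m \<longleftrightarrow>
    (\<forall>F. circulant_fun n F \<longrightarrow>
      (\<exists>\<epsilon>>0. \<forall>x y. row_sum_norm (F (x + omega n ^ m * y) - twisted_prod n m F x y) < \<epsilon>) \<longrightarrow>
      bdd_above (range (\<lambda>x. row_sum_norm (F x))) \<or>
      (\<forall>x y. F (x + omega n ^ m * y) = twisted_prod n m F x y))"

end

theory Submission
  imports Defs "HOL-Number_Theory.Cong"
begin

text \<open>The discrete Fourier transform turns the circulant matrix function \<open>F\<close> into its eigenvalue
  functions \<open>g\<^sub>k\<close>, and conjugation by \<open>\<Omega>\<^sup>m\<close> shifts the index by \<open>m\<close>, so the equation becomes the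
  scalar system \<open>g\<^sub>k (x + \<omega>\<^sup>m y) = g\<^sub>k\<^sub>+\<^sub>m y * g\<^sub>k x\<close> with \<open>k\<close> modulo \<open>n\<close>. If \<open>g\<^sub>k\<close> is unbounded, so is
  \<open>g\<^sub>k\<^sub>+\<^sub>m\<close> (put \<open>x = 0\<close>); for \<open>gcd n m = 1\<close> all \<open>g\<^sub>k\<close> are then unbounded, and dividing by
  \<open>g\<^sub>k x\<close> as this tends to infinity makes them exactly multiplicative and exact solutions. If
  \<open>d = gcd n m > 1\<close>, the system decouples along the residue classes modulo \<open>d\<close>: the exact unbounded
  solution \<open>exp (\<omega>\<^sup>k x)\<close> on one class and the constant \<open>2\<close> on the others refute stability.\<close>

section \<open>Powers of the primitive root of unity\<close>

lemma omega_power_n [simp]: "n > 0 \<Longrightarrow> omega n ^ n = 1"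
  by (simp add: omega_def exp_of_nat_mult [symmetric])

lemma omega_nonzero [simp]: "omega n \<noteq> 0"
  by (simp add: omega_def)

lemma omega_power_mod: "n > 0 \<Longrightarrow> omega n ^ (k mod n) = omega n ^ k"
  by (metis mult_div_mod_eq mult_1 omega_power_n power_add power_mult power_one)

text \<open>Reducing the exponent \<open>r - i\<close> modulo \<open>n\<close> is harmless since
  \<open>omega n ^ n = 1\<close>; the detour through \<open>int\<close> avoids truncated
  subtraction.\<close>

lemma omega_power_split:
  assumes "n > 0"
  shows "omega n ^ r = omega n ^ i * omega n ^ nat ((int r - int i) mod int n)"
proof -
  have "int (r mod n) = int ((i + nat ((int r - int i) mod int n)) mod n)"
    using assms by (simp add: zmod_int mod_simps)
  then have "r mod n = (i + nat ((int r - int i) mod int n)) mod n"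
    by (rule of_nat_eq_iff[THEN iffD1])
  then show ?thesis
    by (metis assms omega_power_mod power_add)
qed

lemma cmod_omega_power [simp]: "cmod (omega n ^ k) = 1"
  by (simp add: omega_def norm_power)

lemma omega_power_eq_iff:
  assumes "i < n" "j < n"
  shows "omega n ^ i = omega n ^ j \<longleftrightarrow> i = j"
proof -
  have n: "n > 0"
    using assms by simp
  have "omega n ^ k = cis (2 * pi * real k / real n)" for k
    by (simp add: omega_def cis_conv_exp exp_of_nat_mult [symmetric] mult_ac)
  then show ?thesis
    using bij_betw_imp_inj_on[OF bij_betw_roots_unity[OF n]] assms
    by (auto dest: inj_onD)
qed

text \<open>A geometric sum: its ratio \<open>q\<close> is an \<open>n\<close>-th root of unity and
  equals 1 only for \<open>i = j\<close>.\<close>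

lemma omega_orthogonality:
  assumes "i < n" "j < n"
  shows "(\<Sum>k<n. omega n ^ (i * k) * inverse (omega n ^ (j * k))) = (if i = j then of_nat n else 0)"
proof -
  define q where "q = omega n ^ i * inverse (omega n ^ j)"
  have q: "omega n ^ (i * k) * inverse (omega n ^ (j * k)) = q ^ k" for k
    by (simp add: q_def power_mult power_mult_distrib power_inverse)
  have "q ^ n = 1"
  proof -
    have "(omega n ^ l) ^ n = 1" for l
      using assms by (metis mult.commute not_less_zero not_gr_zero omega_power_n power_mult power_one)
    then show ?thesis
      by (simp add: q_def power_mult_distrib power_inverse)
  qed
  moreover have "q = 1 \<longleftrightarrow> i = j"
    using omega_power_eq_iff[OF assms] by (auto simp: q_def field_simps)
  ultimately show ?thesis
    unfolding q by (auto simp: geometric_sum)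
qed

section \<open>Cyclic reindexing and the discrete Fourier transform\<close>

lemma sum_cyclic_shift:
  fixes h :: "nat \<Rightarrow> 'a :: comm_monoid_add"
  assumes "n > 0"
  shows "(\<Sum>l<n. h (nat ((int l - int j) mod int n))) = (\<Sum>i<n. h i)"
proof (rule sum.reindex_bij_witness[where i = "\<lambda>i. nat ((int i + int j) mod int n)"
      and j = "\<lambda>l. nat ((int l - int j) mod int n)"])
qed (use assms in \<open>auto simp: mod_simps nat_less_iff\<close>)

text \<open>These are the eigenvalues of \<open>circ n a\<close>. The index \<open>k\<close> is any
  natural number, so that a shift to \<open>k + m\<close> needs no reduction modulo
  \<open>n\<close>; \<open>dft_mod\<close> supplies the periodicity.\<close>

definition dft :: "nat \<Rightarrow> (nat \<Rightarrow> complex) \<Rightarrow> nat \<Rightarrow> complex" where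
  "dft n a k = (\<Sum>i<n. a i * omega n ^ (i * k))"

definition idft :: "nat \<Rightarrow> (nat \<Rightarrow> complex) \<Rightarrow> nat \<Rightarrow> complex" where
  "idft n g i = (\<Sum>k<n. g k * inverse (omega n ^ (i * k))) / of_nat n"

lemma dft_mod: "n > 0 \<Longrightarrow> dft n a (k mod n) = dft n a k"
  unfolding dft_def
  by (metis (no_types, lifting) mult.commute omega_power_mod power_mult)

lemma dft_diff: "dft n (\<lambda>i. a i - b i) k = dft n a k - dft n b k"
  by (simp add: dft_def left_diff_distrib sum_subtractf)

lemma idft_dft:
  assumes "i < n"
  shows "idft n (dft n a) i = a i"
proof -
  have "(\<Sum>k<n. dft n a k * inverse (omega n ^ (i * k))) =
      (\<Sum>k<n. \<Sum>l<n. a l * (omega n ^ (l * k) * inverse (omega n ^ (i * k))))"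
    by (simp add: dft_def sum_distrib_right mult.assoc)
  also have "\<dots> = (\<Sum>l<n. a l * (\<Sum>k<n. omega n ^ (l * k) * inverse (omega n ^ (i * k))))"
    by (subst sum.swap) (simp add: sum_distrib_left)
  also have "\<dots> = (\<Sum>l<n. if l = i then a l * of_nat n else 0)"
    using assms by (intro sum.cong) (auto simp: omega_orthogonality)
  also have "\<dots> = a i * of_nat n"
    using assms by simp
  finally show ?thesis
    using assms by (simp add: idft_def)
qed

lemma dft_idft:
  assumes "n > 0" and per: "g (k mod n) = g k"
  shows "dft n (idft n g) k = g k"
proof -
  \<comment> \<open>Orthogonality applies to indices below \<open>n\<close>, so \<open>k\<close> is
    replaced by its residue; periodicity of both sides restores it at the end.\<close>
  define l where "l = k mod n"
  have l: "l < n"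
    using assms by (simp add: l_def)
  have "dft n (idft n g) l =
      (\<Sum>i<n. \<Sum>k<n. g k * (omega n ^ (l * i) * inverse (omega n ^ (k * i)))) / of_nat n"
    by (simp add: dft_def idft_def sum_distrib_left sum_distrib_right sum_divide_distrib mult_ac)
  also have "\<dots> = (\<Sum>k<n. g k * (\<Sum>i<n. omega n ^ (l * i) * inverse (omega n ^ (k * i)))) / of_nat n"
    by (subst sum.swap) (simp add: sum_distrib_left)
  also have "(\<Sum>k<n. g k * (\<Sum>i<n. omega n ^ (l * i) * inverse (omega n ^ (k * i)))) =
      (\<Sum>k<n. if k = l then g k * of_nat n else 0)"
    using l by (intro sum.cong) (auto simp: omega_orthogonality)
  also have "\<dots> / of_nat n = g l"
    using l by simp
  finally show ?thesis
    using assms by (simp add: l_def dft_mod)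
qed

lemma cmod_dft_le: "cmod (dft n a k) \<le> (\<Sum>i<n. cmod (a i))"
  unfolding dft_def by (rule order.trans[OF norm_sum]) (simp add: norm_mult)

text \<open>By inversion each of the \<open>n\<close> coefficients is at most the average of the
  moduli of the transform. Together with \<open>cmod_dft_le\<close> this transfers boundedness
  between the matrix norm and the eigenvalues, in both directions.\<close>

lemma sum_cmod_le_dft: "(\<Sum>i<n. cmod (a i)) \<le> (\<Sum>k<n. cmod (dft n a k))"
proof -
  have "cmod (a i) \<le> (\<Sum>k<n. cmod (dft n a k)) / real n" if "i < n" for i
  proof -
    have "cmod (idft n (dft n a) i) \<le> (\<Sum>k<n. cmod (dft n a k)) / real n"
      unfolding idft_def norm_divide norm_of_nat
      by (intro divide_right_mono order.trans[OF norm_sum]) (simp_all add: norm_mult norm_inverse)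
    then show ?thesis
      using that by (simp add: idft_dft)
  qed
  then have "(\<Sum>i<n. cmod (a i)) \<le> (\<Sum>i<n. (\<Sum>k<n. cmod (dft n a k)) / real n)"
    by (intro sum_mono) auto
  also have "\<dots> = (\<Sum>k<n. cmod (dft n a k))"
    by (cases "n = 0") auto
  finally show ?thesis .
qed

section \<open>Circulant matrices and their norm\<close>

lemma circ_dims [simp]: "dim_row (circ n a) = n" "dim_col (circ n a) = n"
  by (simp_all add: circ_def)

lemma circ_index [simp]:
  "i < n \<Longrightarrow> j < n \<Longrightarrow> circ n a $$ (i, j) = a (nat ((int j - int i) mod int n))"
  by (simp add: circ_def)

lemma circ_diff: "circ n a - circ n b = circ n (\<lambda>i. a i - b i)"
  by (rule eq_matI) auto

text \<open>Every row is a cyclic shift of row 0, so the maximum is taken over equal sums.\<close>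

lemma row_sum_norm_circ:
  assumes "n > 0"
  shows "row_sum_norm (circ n a) = (\<Sum>i<n. cmod (a i))"
proof -
  have "(\<lambda>i. \<Sum>j<n. cmod (circ n a $$ (i, j))) ` {..<n} = (\<lambda>i. \<Sum>l<n. cmod (a l)) ` {..<n}"
  proof (rule image_cong[OF refl])
    fix i assume "i \<in> {..<n}"
    then show "(\<Sum>j<n. cmod (circ n a $$ (i, j))) = (\<Sum>l<n. cmod (a l))"
      using sum_cyclic_shift[OF assms, of "\<lambda>l. cmod (a l)" i] by simp
  qed
  also have "\<dots> = {\<Sum>l<n. cmod (a l)}"
    using assms by auto
  finally show ?thesis
    by (simp add: row_sum_norm_def)
qed

lemma circ_eqI:
  assumes "\<And>k. k < n \<Longrightarrow> dft n a k = dft n b k"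
  shows "circ n a = circ n b"
proof -
  have "idft n (dft n a) = idft n (dft n b)"
    using assms by (simp add: idft_def fun_eq_iff)
  then have "a i = b i" if "i < n" for i
    using that by (metis idft_dft)
  then show ?thesis
    by (intro eq_matI) (auto simp: nat_less_iff)
qed

lemma dft_eq_if_circ_eq:
  assumes "circ n a = circ n b"
  shows "dft n a k = dft n b k"
proof -
  have "a i = b i" if "i < n" for i
    \<comment> \<open>Row 0 of a circulant matrix lists its coefficients.\<close>
    using arg_cong[OF assms, of "\<lambda>A. A $$ (0, i)"] that by simp
  then show ?thesis
    by (simp add: dft_def)
qed

section \<open>The twisted product on the Fourier side\<close>

definition twisted_conv ::
  "nat \<Rightarrow> nat \<Rightarrow> (nat \<Rightarrow> complex) \<Rightarrow> (nat \<Rightarrow> complex) \<Rightarrow> nat \<Rightarrow> complex" where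
  "twisted_conv n m a b r = (\<Sum>i<n. omega n ^ (m * i) * a i * b (nat ((int r - int i) mod int n)))"

text \<open>A convolution theorem: shifting \<open>b\<close> by \<open>i\<close> contributes
  \<open>omega n ^ (i * k)\<close>, which merges with the weight \<open>omega n ^ (m * i)\<close>
  and so moves the frequency of \<open>a\<close> from \<open>k\<close> to
  \<open>k + m\<close>.\<close>

lemma dft_twisted_conv:
  assumes "n > 0"
  shows "dft n (twisted_conv n m a b) k = dft n a (k + m) * dft n b k"
proof -
  have shift: "(\<Sum>r<n. b (nat ((int r - int i) mod int n)) * omega n ^ (r * k)) =
      omega n ^ (i * k) * dft n b k" for i
  proof -
    have split: "omega n ^ (r * k) = omega n ^ (i * k) * omega n ^ (nat ((int r - int i) mod int n) * k)" for r
      by (metis omega_power_split[OF assms] power_mult power_mult_distrib)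
    have "(\<Sum>r<n. b (nat ((int r - int i) mod int n)) * omega n ^ (r * k)) =
        omega n ^ (i * k) *
          (\<Sum>r<n. (\<lambda>s. b s * omega n ^ (s * k)) (nat ((int r - int i) mod int n)))"
      unfolding sum_distrib_left
    proof (rule sum.cong[OF refl])
      show "b (nat ((int r - int i) mod int n)) * omega n ^ (r * k) =
          omega n ^ (i * k) *
            (\<lambda>s. b s * omega n ^ (s * k)) (nat ((int r - int i) mod int n))" for r
        unfolding split[of r] by (simp add: mult_ac)
    qed
    then show ?thesis
      by (subst (asm) sum_cyclic_shift[OF assms]) (simp add: dft_def)
  qed
  have "dft n (twisted_conv n m a b) k =
      (\<Sum>i<n. omega n ^ (m * i) * a i *
        (\<Sum>r<n. b (nat ((int r - int i) mod int n)) * omega n ^ (r * k)))"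
    unfolding dft_def twisted_conv_def sum_distrib_right sum_distrib_left
    by (subst sum.swap) (simp add: mult_ac)
  then show ?thesis
    unfolding shift dft_def[of n a] by (simp add: sum_distrib_left algebra_simps power_add)
qed

lemma pow_mat_diag: "mat_diag n f ^\<^sub>m m = mat_diag n (\<lambda>j. f j ^ m)"
proof (induction m)
  case 0
  then show ?case
    by (intro eq_matI) (auto simp: mat_diag_def)
next
  case (Suc m)
  then show ?case
    by (simp add: power_Suc2 del: power_Suc)
qed

text \<open>Conjugation multiplies entry \<open>(j, l)\<close> by the power of
  \<open>omega n\<close> with exponent \<open>m * (l - j)\<close>. This depends only on
  \<open>l - j\<close> modulo \<open>n\<close>, so the conjugate is again circulant and the product
  is a convolution of coefficients.\<close>

lemma twisted_prod_circ:
  assumes "n > 0" "F x = circ n b" "F y = circ n a"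
  shows "twisted_prod n m F x y = circ n (twisted_conv n m a b)"
proof -
  let ?w = "omega n"
  have ca: "circ n a \<in> carrier_mat n n" for a
    by (simp add: circ_def)
  define A where "A = mat n n (\<lambda>(j, l). inverse (?w ^ j) ^ m * circ n a $$ (j, l) * (?w ^ l) ^ m)"
  have "(Omega_inv n ^\<^sub>m m) * circ n a * (Omega n ^\<^sub>m m) = A"
    unfolding Omega_inv_def Omega_def pow_mat_diag mat_diag_mult_left[OF ca]
    by (subst mat_diag_mult_right[where nr = n]) (auto simp: A_def)
  then have eq: "twisted_prod n m F x y = A * circ n b"
    by (simp add: twisted_prod_def assms)
  show ?thesis
    unfolding eq
  proof (rule eq_matI)
    fix j k assume jk: "j < dim_row (circ n (twisted_conv n m a b))"
      "k < dim_col (circ n (twisted_conv n m a b))"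
    have w: "inverse (?w ^ j) ^ m * (?w ^ l) ^ m = ?w ^ (m * nat ((int l - int j) mod int n))" for l
    proof -
      have "?w ^ l = ?w ^ j * ?w ^ nat ((int l - int j) mod int n)"
        by (rule omega_power_split[OF assms(1)])
      then have "inverse (?w ^ j) * ?w ^ l = ?w ^ nat ((int l - int j) mod int n)"
        by simp
      then show ?thesis
        by (metis mult.commute power_mult power_mult_distrib)
    qed
    have "(A * circ n b) $$ (j, k) = (\<Sum>l<n. A $$ (j, l) * circ n b $$ (l, k))"
      using jk by (simp add: A_def scalar_prod_def lessThan_atLeast0)
    also have "\<dots> = (\<Sum>l<n. (\<lambda>i. ?w ^ (m * i) * a i *
        b (nat ((int k - int j - int i) mod int n))) (nat ((int l - int j) mod int n)))"
    proof (rule sum.cong[OF refl])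
      fix l assume "l \<in> {..<n}"
      then show "A $$ (j, l) * circ n b $$ (l, k) = (\<lambda>i. ?w ^ (m * i) * a i *
          b (nat ((int k - int j - int i) mod int n))) (nat ((int l - int j) mod int n))"
        using jk assms(1) by (simp add: A_def mod_simps w [symmetric] mult_ac)
    qed
    also have "\<dots> = (\<Sum>i<n. ?w ^ (m * i) * a i * b (nat ((int k - int j - int i) mod int n)))"
      by (rule sum_cyclic_shift[OF assms(1)])
    also have "\<dots> = circ n (twisted_conv n m a b) $$ (j, k)"
      using jk assms(1) by (simp add: twisted_conv_def mod_simps)
    finally show "(A * circ n b) $$ (j, k) = circ n (twisted_conv n m a b) $$ (j, k)" .
  qed (simp_all add: A_def)
qed

lemma dft_defect:
  assumes "n > 0"
  shows "dft n (\<lambda>i. c i - twisted_conv n m a b i) k = dft n c k - dft n a (k + m) * dft n b k"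
  using assms by (simp add: dft_diff dft_twisted_conv)

section \<open>Scalar functional inequalities with an unbounded solution\<close>

lemma zero_if_mult_unbounded_bounded:
  fixes g :: "'a \<Rightarrow> complex"
  assumes "\<not> bdd_above (range (\<lambda>x. cmod (g x)))"
    and "\<And>x. cmod (c * g x) \<le> B"
  shows "c = 0"
proof (rule ccontr)
  assume "c \<noteq> 0"
  then have "cmod (g x) \<le> B / cmod c" for x
    using assms(2)[of x] by (simp add: norm_mult field_simps)
  then show False
    using assms(1) by (auto simp: bdd_above_def)
qed

text \<open>Expand \<open>g (x + \<alpha> y + \<alpha> z)\<close> in two ways and compare the coefficients of the unbounded \<open>g x\<close>.\<close>
lemma multiplicative_if_unbounded:
  fixes g h :: "complex \<Rightarrow> complex"
  assumes unbdd: "\<not> bdd_above (range (\<lambda>x. cmod (g x)))"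
    and approx: "\<And>x y. cmod (g (x + \<alpha> * y) - h y * g x) \<le> e"
  shows "h (y + z) = h y * h z"
proof -
  have "cmod ((h (y + z) - h y * h z) * g x) \<le> e + e + cmod (h z) * e" for x
  proof -
    let ?A = "g (x + \<alpha> * (y + z)) - h (y + z) * g x"
    let ?B = "g (x + \<alpha> * y + \<alpha> * z) - h z * g (x + \<alpha> * y)"
    let ?C = "g (x + \<alpha> * y) - h y * g x"
    have "(h (y + z) - h y * h z) * g x = - ?A + ?B + h z * ?C"
      by (simp add: algebra_simps)
    also have "cmod \<dots> \<le> cmod ?A + cmod ?B + cmod (h z) * cmod ?C"
      by (metis (no_types, lifting) norm_minus_cancel norm_mult norm_triangle_ineq
          norm_triangle_mono order_refl)
    also have "\<dots> \<le> e + e + cmod (h z) * e"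
      by (intro add_mono mult_left_mono approx) auto
    finally show ?thesis .
  qed
  then have "h (y + z) - h y * h z = 0"
    by (rule zero_if_mult_unbounded_bounded[OF unbdd])
  then show ?thesis
    by simp
qed

text \<open>Every point is \<open>0 + \<alpha> * y\<close> for some \<open>y\<close>, so
  \<open>g\<close> stays within \<open>e\<close> of \<open>h y * g 0\<close> and a bound on
  \<open>h\<close> would bound \<open>g\<close>.\<close>

lemma unbounded_step:
  fixes g h :: "complex \<Rightarrow> complex"
  assumes unbdd: "\<not> bdd_above (range (\<lambda>x. cmod (g x)))"
    and approx: "\<And>x y. cmod (g (x + \<alpha> * y) - h y * g x) \<le> e"
    and "\<alpha> \<noteq> 0"
  shows "\<not> bdd_above (range (\<lambda>x. cmod (h x)))"
proof
  assume "bdd_above (range (\<lambda>x. cmod (h x)))"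
  then obtain B where B: "\<And>x. cmod (h x) \<le> B"
    by (auto simp: bdd_above_def)
  have "cmod (g x) \<le> e + B * cmod (g 0)" for x
  proof -
    have "cmod (g x) \<le> cmod (g x - h (x / \<alpha>) * g 0) + cmod (h (x / \<alpha>) * g 0)"
      by (metis diff_add_cancel norm_triangle_ineq)
    also have "\<dots> \<le> e + B * cmod (g 0)"
      using approx[of 0 "x / \<alpha>"] B[of "x / \<alpha>"] \<open>\<alpha> \<noteq> 0\<close>
      by (auto simp: norm_mult intro!: add_mono mult_right_mono)
    finally show ?thesis .
  qed
  with unbdd show False
    by (auto simp: bdd_above_def)
qed

text \<open>Multiplicativity lets \<open>g x\<close> be factored out of the defect; the remaining
  coefficient does not depend on \<open>x\<close> and hence vanishes.\<close>

lemma exact_if_unbounded: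
  fixes g h :: "complex \<Rightarrow> complex"
  assumes unbdd: "\<not> bdd_above (range (\<lambda>x. cmod (g x)))"
    and approx: "\<And>x y. cmod (g (x + \<alpha> * y) - h y * g x) \<le> e"
    and mult: "\<And>x y. g (x + y) = g x * g y"
  shows "g (x + \<alpha> * y) = h y * g x"
proof -
  have "cmod ((g (\<alpha> * y) - h y) * g x) \<le> e" for x
    using approx[of x y] by (simp add: mult algebra_simps)
  then have "g (\<alpha> * y) - h y = 0"
    by (rule zero_if_mult_unbounded_bounded[OF unbdd])
  then show ?thesis
    by (simp add: mult)
qed

section \<open>The two directions of the equivalence\<close>

lemma stable_if_coprime:
  assumes n: "n > 0" and "coprime n m"
  shows "equation_stable n m"
  unfolding equation_stable_def
proof (intro allI impI)
  fix F
  assume "circulant_fun n F"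
  then obtain f where F: "\<And>x. F x = circ n (\<lambda>i. f i x)"
    unfolding circulant_fun_def by blast
  assume "\<exists>\<epsilon>>0. \<forall>x y. row_sum_norm (F (x + omega n ^ m * y) - twisted_prod n m F x y) < \<epsilon>"
  then obtain e where
    e: "\<And>x y. row_sum_norm (F (x + omega n ^ m * y) - twisted_prod n m F x y) < e"
    by blast
  let ?\<alpha> = "omega n ^ m"
  define g where "g k x = dft n (\<lambda>i. f i x) k" for k x
  have approx: "cmod (g k (x + ?\<alpha> * y) - g (k + m) y * g k x) \<le> e" for k x y
  proof -
    let ?d = "\<lambda>i. f i (x + ?\<alpha> * y) - twisted_conv n m (\<lambda>i. f i y) (\<lambda>i. f i x) i"
    have "F (x + ?\<alpha> * y) - twisted_prod n m F x y = circ n ?d"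
      by (simp add: F twisted_prod_circ[OF n F F] circ_diff)
    then have "(\<Sum>i<n. cmod (?d i)) < e"
      using e[of x y] n by (simp add: row_sum_norm_circ)
    then show ?thesis
      using cmod_dft_le[of n ?d k] n by (simp add: dft_defect g_def)
  qed
  let ?unbdd = "\<lambda>k. \<not> bdd_above (range (\<lambda>x. cmod (g k x)))"
  show "bdd_above (range (\<lambda>x. row_sum_norm (F x))) \<or>
      (\<forall>x y. F (x + ?\<alpha> * y) = twisted_prod n m F x y)"
  proof (rule disj_imp[THEN iffD2], rule impI)
    assume unbdd: "\<not> bdd_above (range (\<lambda>x. row_sum_norm (F x)))"
    have "\<exists>k<n. ?unbdd k"
    proof (rule ccontr)
      assume "\<not> (\<exists>k<n. ?unbdd k)"
      then have "\<forall>k. \<exists>B. k < n \<longrightarrow> (\<forall>x. cmod (g k x) \<le> B)"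
        by (auto simp: bdd_above_def)
      then obtain B where "\<And>k x. k < n \<Longrightarrow> cmod (g k x) \<le> B k"
        by metis
      then have "(\<Sum>k<n. cmod (g k x)) \<le> (\<Sum>k<n. B k)" for x
        by (intro sum_mono) simp
      then have "row_sum_norm (F x) \<le> (\<Sum>k<n. B k)" for x
        unfolding F row_sum_norm_circ[OF n] g_def by (rule order.trans[OF sum_cmod_le_dft])
      with unbdd show False
        by (auto simp: bdd_above_def)
    qed
    then obtain k0 where k0: "k0 < n" "?unbdd k0"
      by auto
    have iter: "?unbdd (k0 + t * m)" for t
    proof (induction t)
      case (Suc t)
      then show ?case
        using unbounded_step[OF Suc.IH approx] by (simp add: ac_simps)
    qed (use k0 in simp)
    have unbdd_all: "?unbdd k" for k
    proof -
      obtain u where "[m * u = 1] (mod n)"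
        using cong_solve_coprime_nat[of m n] assms by (auto simp: coprime_commute)
      \<comment> \<open>Here \<open>u\<close> inverts \<open>m\<close> modulo \<open>n\<close>, and
        \<open>k + (n - k0)\<close> represents the difference \<open>k - k0\<close> without leaving
        the naturals.\<close>
      then have "[k0 + m * u * (k + (n - k0)) = k0 + 1 * (k + (n - k0))] (mod n)"
        by (intro cong_add cong_mult cong_refl)
      moreover define t where "t = u * (k + (n - k0))"
      ultimately have "[k0 + t * m = k] (mod n)"
        using k0 by (simp add: cong_def mult_ac)
      then have "g (k0 + t * m) = g k"
        unfolding g_def cong_def fun_eq_iff by (metis dft_mod n)
      then show ?thesis
        using iter[of t] by simp
    qed
    have mult: "g k (x + y) = g k x * g k y" for k x y
    proof -
      \<comment> \<open>Multiplicativity is obtained for the successor index, so the predecessor of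
        \<open>k\<close> is needed: \<open>k + (n - 1) * m\<close> stands for \<open>k - m\<close>
        modulo \<open>n\<close>.\<close>
      have "g (k + (n - 1) * m + m) = g k"
      proof -
        have "k + (n - 1) * m + m = k + n * m"
          using n by (cases n) auto
        then show ?thesis
          unfolding g_def fun_eq_iff by (metis dft_mod n mod_mult_self2)
      qed
      then show ?thesis
        using multiplicative_if_unbounded[OF unbdd_all approx, of "k + (n - 1) * m" x y] by simp
    qed
    have "g k (x + ?\<alpha> * y) = g (k + m) y * g k x" for k x y
      by (rule exact_if_unbounded[OF unbdd_all approx mult])
    then show "\<forall>x y. F (x + ?\<alpha> * y) = twisted_prod n m F x y"
      using n by (auto simp: twisted_prod_circ[OF n F F] F g_def dft_twisted_conv intro!: circ_eqI)
  qed
qed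

lemma not_stable_if_not_coprime:
  assumes n: "n \<ge> 2" and gcd: "gcd n m \<noteq> 1"
  shows "\<not> equation_stable n m"
proof
  assume stable: "equation_stable n m"
  let ?\<alpha> = "omega n ^ m"
  have n0: "n > 0"
    using n by simp
  \<comment> \<open>As \<open>gcd n m\<close> divides both \<open>n\<close> and \<open>m\<close>,
    the case distinction is \<open>n\<close>-periodic and unaffected by
    \<open>k \<mapsto> k + m\<close>. The constant 2 is chosen because it differs from its
    square.\<close>
  define g where "g x k = (if gcd n m dvd k then exp (omega n ^ k * x) else 2)" for x k
  define f where "f x = idft n (g x)" for x
  define F where "F x = circ n (f x)" for x
  have "g x (k mod n) = g x k" for x k
    using n0 by (simp add: g_def omega_power_mod dvd_mod_iff)
  then have dft_f: "dft n (f x) k = g x k" for x k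
    unfolding f_def by (intro dft_idft n0)
  have circulant: "circulant_fun n F"
    unfolding circulant_fun_def F_def by (rule exI[of _ "\<lambda>i x. f x i"]) simp
  \<comment> \<open>The defect is 0 in the exponential case and \<open>2 - 2 * 2\<close>
    otherwise.\<close>
  have defect: "cmod (g (x + ?\<alpha> * y) k - g y (k + m) * g x k) \<le> 2" for x y k
    by (auto simp: g_def dvd_add_left_iff algebra_simps power_add simp flip: exp_add)
  have approx: "row_sum_norm (F (x + ?\<alpha> * y) - twisted_prod n m F x y) < 2 * real n + 1" for x y
  proof -
    let ?d = "\<lambda>i. f (x + ?\<alpha> * y) i - twisted_conv n m (f y) (f x) i"
    have "row_sum_norm (F (x + ?\<alpha> * y) - twisted_prod n m F x y) = (\<Sum>i<n. cmod (?d i))"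
      by (simp add: F_def twisted_prod_circ[OF n0 F_def F_def] circ_diff row_sum_norm_circ n0)
    also have "\<dots> \<le> (\<Sum>k<n. cmod (dft n ?d k))"
      by (rule sum_cmod_le_dft)
    also have "\<dots> \<le> (\<Sum>k<n. 2)"
      using defect by (intro sum_mono) (simp add: dft_defect n0 dft_f)
    finally show ?thesis
      by simp
  qed
  have "\<not> bdd_above (range (\<lambda>x. row_sum_norm (F x)))"
  proof
    assume "bdd_above (range (\<lambda>x. row_sum_norm (F x)))"
    then obtain B where B: "\<And>x. row_sum_norm (F x) \<le> B"
      by (auto simp: bdd_above_def)
    \<comment> \<open>Index 0 always lies in the exponential class, and at the real point
      \<open>B\<close> its eigenvalue \<open>exp B\<close> exceeds the supposed bound
      \<open>B\<close>.\<close>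
    have "exp B = cmod (dft n (f (of_real B)) 0)"
      by (simp add: dft_f g_def norm_exp_eq_Re)
    also have "\<dots> \<le> B"
      using cmod_dft_le[of n "f (of_real B)" 0] B[of "of_real B"] n0
      by (simp add: F_def row_sum_norm_circ)
    finally show False
      using exp_ge_add_one_self[of B] by simp
  qed
  moreover have "\<exists>\<epsilon>>0. \<forall>x y. row_sum_norm (F (x + ?\<alpha> * y) - twisted_prod n m F x y) < \<epsilon>"
    using approx by (intro exI[of _ "2 * real n + 1"]) auto
  ultimately have "\<forall>x y. F (x + ?\<alpha> * y) = twisted_prod n m F x y"
    using stable[unfolded equation_stable_def, THEN spec[of _ F]] circulant by simp
  then have "F (0 + ?\<alpha> * 0) = twisted_prod n m F 0 0"
    by blast
  then have "circ n (f 0) = circ n (twisted_conv n m (f 0) (f 0))"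
    by (simp add: twisted_prod_circ[OF n0 F_def F_def] F_def)
  \<comment> \<open>Index 1 lies outside the exponential class since \<open>gcd n m\<close> is not
    1; there exactness would read \<open>2 = 2 * 2\<close>.\<close>
  then have "dft n (f 0) 1 = dft n (twisted_conv n m (f 0) (f 0)) 1"
    by (rule dft_eq_if_circ_eq)
  then have "g 0 1 = g 0 (1 + m) * g 0 1"
    by (simp only: dft_twisted_conv[OF n0] dft_f)
  moreover have "\<not> gcd n m dvd 1"
    using gcd by simp
  moreover from this have "\<not> gcd n m dvd 1 + m"
    by (simp only: dvd_add_left_iff[OF gcd_dvd2] not_False_eq_True)
  ultimately show False
    by (simp add: g_def)
qed

theorem theorem5p2:
  fixes n m :: nat
  assumes "n \<ge> 2" and "m < n"
  shows "equation_stable n m \<longleftrightarrow> gcd n m = 1"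
  using stable_if_coprime[of n m] not_stable_if_not_coprime[of n m] assms
  by (auto simp: coprime_iff_gcd_eq_1)

end
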